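(* Let $r,k\geq 2$ be integers and let $S_{(r,k)}$ be the numerical semigroup associated to the $(r,k)$-configurations. Then $S_{(r,k)}$ admits the pattern $X_1+X_2-n$ for all $n\in\{1,\dots,\gcd(r,k)\}$.
   Context: An incidence structure consists of a finite set of points, a finite set of lines, and an incidence relation between them. For integers $r,k\geq 2$, a (combinatorial) $(v,b,r,k)$-configuration is an incidence structure with $v$ points and $b$ lines such that there are $r$ lines through every point, $k$ points on every line, and through any pair of distinct points there is at most one line. An $(r,k)$-configuration is a $(v,b,r,k)$-configuration for some $v,b$. Define $S_{(r,k)}\subseteq\{0,1,2,\dots\}$ as the set consisting of $0$ together with all positive integers $d$ for which there exists a $(v,b,r,k)$-configuration with $v=d\frac{k}{\gcd(r,k)}$ and $b=d\frac{r}{\gcd(r,k)}$. A numerical semigroup is a subset of $\{0,1,2,\dots\}$ that contains $0$, is closed under addition, and has finite complement in $\{0,1,2,\dots\}$. It is known that $S_{(r,k)}$ is a numerical semigroup for all integers $r,k\geq 2$. A pattern of length $m$ admitted by a numerical semigroup $S$ is a polynomial $p(X_1,\dots,X_m)$ with non-zero integer coefficients such that, for every ordered sequence of $m$ elements $s_1\geq\dots\geq s_m$ from $S$, one has $p(s_1,\dots,s_m)\in S$.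
   Formalization: The elements s_1 ≥ s_2 substituted into the pattern are taken to be non-zero elements of S_(r,k); with 0 allowed the claim is false, since s_1 = s_2 = 0 gives −n, which is not in S_(r,k). *)

theory Defs
  imports Main "HOL-Library.Poly_Mapping"
begin

definition configuration ::
  "nat \<Rightarrow> nat \<Rightarrow> nat \<Rightarrow> nat \<Rightarrow> 'p set \<Rightarrow> 'l set \<Rightarrow> ('p \<times> 'l) set \<Rightarrow> bool" where
  "configuration v b r k P L I \<longleftrightarrow>
     r \<ge> 2 \<and> k \<ge> 2 \<and> finite P \<and> finite L \<and> I \<subseteq> P \<times> L \<and>
     card P = v \<and> card L = b \<and>
     (\<forall>p\<in>P. card {l \<in> L. (p, l) \<in> I} = r) \<and>
     (\<forall>l\<in>L. card {p \<in> P. (p, l) \<in> I} = k) \<and>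
     (\<forall>p\<in>P. \<forall>q\<in>P. p \<noteq> q \<longrightarrow> card {l \<in> L. (p, l) \<in> I \<and> (q, l) \<in> I} \<le> 1)"

text \<open>Points and lines are finite, so taking both from the natural numbers loses no generality.
  The divisions below are exact.\<close>

definition config_semigroup :: "nat \<Rightarrow> nat \<Rightarrow> nat set" where
  "config_semigroup r k =
     {0} \<union> {d. d > 0 \<and>
       (\<exists>(P :: nat set) (L :: nat set) I.
          configuration (d * (k div gcd r k)) (d * (r div gcd r k)) r k P L I)}"

text \<open>Multivariate integer polynomials: finitely supported maps from monomials (finitely supported
  exponent maps) to coefficients, so that the coefficients of the monomials in \<open>keys p\<close> are exactly
  the non-zero ones.\<close>

type_synonym int_mpoly = "(nat \<Rightarrow>\<^sub>0 nat) \<Rightarrow>\<^sub>0 int"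

definition mp_var :: "nat \<Rightarrow> int_mpoly" where
  "mp_var i = Poly_Mapping.single (Poly_Mapping.single i 1) 1"

definition mp_vars :: "int_mpoly \<Rightarrow> nat set" where
  "mp_vars p = (\<Union>t \<in> Poly_Mapping.keys p. Poly_Mapping.keys t)"

definition mp_eval :: "(nat \<Rightarrow> int) \<Rightarrow> int_mpoly \<Rightarrow> int" where
  "mp_eval f p = (\<Sum>t \<in> Poly_Mapping.keys p.
     Poly_Mapping.lookup p t * (\<Prod>i \<in> Poly_Mapping.keys t. f i ^ Poly_Mapping.lookup t i))"

text \<open>\<open>admits_pattern_on A S m p\<close>: the polynomial \<open>p\<close> in exactly the variables \<open>X\<^sub>1, \<dots>, X\<^sub>m\<close> sends every
  non-increasing sequence of \<open>m\<close> elements of \<open>A\<close> into \<open>S\<close>. The membership is between integers, so a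
  negative value is never in \<open>S\<close>.

  For homogeneous patterns one takes \<open>A = S\<close>. For a pattern with negative constant term that is
  unsatisfiable, because of the zero sequence (see the last lemma below); there the arguments are
  taken from the non-zero elements, \<open>A = S - {0}\<close>.\<close>

definition admits_pattern_on :: "nat set \<Rightarrow> nat set \<Rightarrow> nat \<Rightarrow> int_mpoly \<Rightarrow> bool" where
  "admits_pattern_on A S m p \<longleftrightarrow> mp_vars p = {1..m} \<and>
     (\<forall>s :: nat \<Rightarrow> nat.
        (\<forall>i\<in>{1..m}. s i \<in> A) \<longrightarrow>
        (\<forall>i\<in>{1..m}. \<forall>j\<in>{1..m}. i \<le> j \<longrightarrow> s j \<le> s i) \<longrightarrow>
        mp_eval (\<lambda>i. int (s i)) p \<in> int ` S)"

lemma mp_sum_minus_const: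
  fixes n :: nat
  assumes "n > 0"
  shows "mp_eval f (mp_var 1 + mp_var 2 - of_nat n) = f 1 + f 2 - int n"
    and "mp_vars (mp_var 1 + mp_var 2 - of_nat n) = {1, 2}"
proof -
  let ?x = "Poly_Mapping.single 1 1 :: nat \<Rightarrow>\<^sub>0 nat"
  let ?y = "Poly_Mapping.single 2 1 :: nat \<Rightarrow>\<^sub>0 nat"
  let ?p = "mp_var 1 + mp_var 2 - of_nat n"
  have ne: "?x \<noteq> ?y" "?x \<noteq> 0" "?y \<noteq> 0"
    by (auto simp: poly_mapping_eq_iff fun_eq_iff lookup_single when_def)
  have l: "Poly_Mapping.lookup ?p t =
      (if t = ?x then 1 else if t = ?y then 1 else if t = 0 then - int n else 0)" for t
    using ne unfolding mp_var_def
    by (auto simp: lookup_add lookup_minus lookup_single lookup_of_nat when_def)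
  have k: "Poly_Mapping.keys ?p = {?x, ?y, 0}"
    using assms ne by (intro set_eqI, unfold in_keys_iff l) auto
  show "mp_eval f ?p = f 1 + f 2 - int n"
    unfolding mp_eval_def k l using ne by simp
  show "mp_vars ?p = {1, 2}"
    unfolding mp_vars_def k by (simp add: insert_commute)
qed

lemma not_admits_pattern_with_zero:
  assumes "n > 0" "0 \<in> S"
  shows "\<not> admits_pattern_on S S 2 (mp_var 1 + mp_var 2 - of_nat n)"
proof
  assume "admits_pattern_on S S 2 (mp_var 1 + mp_var 2 - of_nat n)"
  then have seq: "\<forall>s. (\<forall>i\<in>{1..2}. s i \<in> S) \<longrightarrow>
      (\<forall>i\<in>{1..2}. \<forall>j\<in>{1..2}. i \<le> j \<longrightarrow> s j \<le> s i) \<longrightarrow>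
      mp_eval (\<lambda>i. int (s i)) (mp_var 1 + mp_var 2 - of_nat n) \<in> int ` S"
    unfolding admits_pattern_on_def by (rule conjunct2)
  have "- int n \<in> int ` S"
    using spec[OF seq, of "\<lambda>_. 0"] assms(2)
    unfolding mp_sum_minus_const(1)[OF assms(1)] by simp
  then show False
    using assms(1) by auto
qed

end

theory Submission
  imports Defs "HOL-Library.Nat_Bijection"
begin

text \<open>
  The pattern says that two configurations with parameters \<open>d\<close> and \<open>e\<close> can be merged into one with
  parameter \<open>d + e - n\<close>. Relative to their disjoint union, this means saving \<open>a = n k / gcd r k\<close>
  points and \<open>b = n r / gcd r k\<close> lines, where \<open>1 \<le> a \<le> k\<close>, \<open>1 \<le> b \<le> r\<close> and \<open>b k = a r\<close>.

  Take \<open>b\<close> lines \<open>T\<close> through a point \<open>p\<close> of the first configuration and \<open>a\<close> points \<open>Y\<close> on a line \<open>l\<close>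
  of the second, and delete the lines \<open>T\<close> and the points \<open>Y\<close>. The points of the first configuration
  then lack \<open>b k\<close> incidences and the lines of the second lack \<open>a r\<close>. These numbers agree, so the
  incidences can be restored by placing points of the first configuration on lines of the second.
  The point \<open>p\<close> lacks \<open>b\<close> lines, the line \<open>l\<close> lacks \<open>a\<close> points, and each other deficient point or
  line lacks exactly one incidence, because the deleted lines meet only in \<open>p\<close> and the deleted points
  are joined only by \<open>l\<close>.

  What has to be avoided is a second line through two points. The only new line with several points of
  the first configuration will be \<open>l\<close>, and the only point of the first configuration on several new
  lines will be \<open>p\<close>. Place on \<open>l\<close> the point \<open>p\<close> and \<open>a - 1\<close> further points of one deleted line \<open>m\<close>;
  since \<open>m\<close> was their only joining line, they are no longer collinear. Dually, place \<open>p\<close> on \<open>l\<close>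
  and on \<open>b - 1\<close> further lines through one deleted point \<open>y\<close>; these lines no longer meet. The
  remaining deficient points and lines are equally many, and any bijection between them completes the
  construction. The lemma \<open>configuration_glue\<close> checks the conditions under which such a gluing is a
  configuration, and \<open>merged_configuration_exists\<close> makes the choices just described.
\<close>

section \<open>Linearity, duality and change of carrier\<close>

text \<open>Stated with \<open>p = q \<or> l = m\<close>, linearity is symmetric in points and lines: two lines meet in at most
  one point. This gives duality.\<close>

lemma configuration_iff:
  "configuration v b r k P L I \<longleftrightarrow>
     r \<ge> 2 \<and> k \<ge> 2 \<and> finite P \<and> finite L \<and> I \<subseteq> P \<times> L \<and> card P = v \<and> card L = b \<and>
     (\<forall>p\<in>P. card {l. (p, l) \<in> I} = r) \<and>
     (\<forall>l\<in>L. card {p. (p, l) \<in> I} = k) \<and>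
     (\<forall>p q l m. (p, l) \<in> I \<longrightarrow> (q, l) \<in> I \<longrightarrow> (p, m) \<in> I \<longrightarrow> (q, m) \<in> I \<longrightarrow> p = q \<or> l = m)"
proof (cases "finite L \<and> I \<subseteq> P \<times> L")
  case True
  have row: "{l \<in> L. (p, l) \<in> I} = {l. (p, l) \<in> I}" for p
    using True by auto
  have col: "{p \<in> P. (p, l) \<in> I} = {p. (p, l) \<in> I}" for l
    using True by auto
  have "(\<forall>p\<in>P. \<forall>q\<in>P. p \<noteq> q \<longrightarrow> card {l \<in> L. (p, l) \<in> I \<and> (q, l) \<in> I} \<le> 1) \<longleftrightarrow>
      (\<forall>p\<in>P. \<forall>q\<in>P. p \<noteq> q \<longrightarrow>
        (\<forall>l\<in>{l \<in> L. (p, l) \<in> I \<and> (q, l) \<in> I}. \<forall>m\<in>{l \<in> L. (p, l) \<in> I \<and> (q, l) \<in> I}. l = m))"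
    using True by (simp add: card_le_Suc0_iff_eq)
  also have "\<dots> \<longleftrightarrow>
      (\<forall>p q l m. (p, l) \<in> I \<longrightarrow> (q, l) \<in> I \<longrightarrow> (p, m) \<in> I \<longrightarrow> (q, m) \<in> I \<longrightarrow> p = q \<or> l = m)"
    using True by blast
  finally show ?thesis
    unfolding configuration_def row col by simp
next
  case False
  then show ?thesis
    unfolding configuration_def by blast
qed

lemma configuration_dual:
  assumes "configuration v b r k P L I"
  shows "configuration b v k r L P (I\<inverse>)"
proof -
  note C = assms[unfolded configuration_iff]
  have "l = m \<or> p = q"
    if "(p, l) \<in> I" "(p, m) \<in> I" "(q, l) \<in> I" "(q, m) \<in> I" for p q l m
    using C that by blast
  then show ?thesis
    using C unfolding configuration_iff by auto
qed

lemma configuration_image: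
  assumes c: "configuration v b r k P L I"
    and f: "inj f" and h: "inj h"
  shows "configuration v b r k (f ` P) (h ` L) (map_prod f h ` I)"
proof -
  have row: "{l. (f p, l) \<in> map_prod f h ` I} = h ` {l. (p, l) \<in> I}" for p
    using f by (force simp: inj_eq)
  have col: "{p. (p, h l) \<in> map_prod f h ` I} = f ` {p. (p, l) \<in> I}" for l
    using h by (force simp: inj_eq)
  have lin: "x = y \<or> l = m"
    if "(x, l) \<in> map_prod f h ` I" "(y, l) \<in> map_prod f h ` I"
      "(x, m) \<in> map_prod f h ` I" "(y, m) \<in> map_prod f h ` I" for x y l m
  proof -
    from that(1,4) obtain x' l' y' m' where
      eq: "x = f x'" "l = h l'" "y = f y'" "m = h m'" by auto
    have mem: "(f u, h w) \<in> map_prod f h ` I \<longleftrightarrow> (u, w) \<in> I" for u w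
      using f h by (auto simp: inj_eq)
    show ?thesis
      using c that unfolding eq mem configuration_iff by blast
  qed
  have card: "card (f ` A) = card A" "card (h ` B) = card B" for A B
    using f h by (simp_all add: card_image inj_on_subset)
  show ?thesis
    unfolding configuration_iff
  proof (intro conjI ballI allI impI)
    show "map_prod f h ` I \<subseteq> f ` P \<times> h ` L"
      using c unfolding configuration_iff by auto
    show "x = y \<or> l = m"
      if "(x, l) \<in> map_prod f h ` I" "(y, l) \<in> map_prod f h ` I"
        "(x, m) \<in> map_prod f h ` I" "(y, m) \<in> map_prod f h ` I" for x y l m
      using lin[OF that] .
  qed (use c in \<open>auto simp: configuration_iff row col card\<close>)
qed

section \<open>Gluing two configurations\<close>

text \<open>
  Here \<open>X\<close> is the set of new incidences between points of the first and lines of the second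
  configuration. The two degree conditions say that \<open>X\<close> replaces what is lost with \<open>T\<close> and \<open>Y\<close>. The
  last three conditions exclude a second line through two points: two points of the first
  configuration could share a surviving old line and a new one, or two new ones, and a point of the
  first and one of the second could share two new lines. Two points of the second configuration share
  no line of the first one.
\<close>

lemma configuration_glue:
  assumes c1: "configuration v1 b1 r k P1 L1 I1"
    and c2: "configuration v2 b2 r k P2 L2 I2"
    and T: "T \<subseteq> L1" and Y: "Y \<subseteq> P2" and X: "X \<subseteq> P1 \<times> L2"
    and row: "\<And>x. x \<in> P1 \<Longrightarrow> card {l. (x, l) \<in> X} = card {m \<in> T. (x, m) \<in> I1}"
    and col: "\<And>l. l \<in> L2 \<Longrightarrow> card {x. (x, l) \<in> X} = card {y \<in> Y. (y, l) \<in> I2}"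
    and old_new: "\<And>x x' l m. \<lbrakk>(x, l) \<in> X; (x', l) \<in> X; x \<noteq> x'; (x, m) \<in> I1; (x', m) \<in> I1\<rbrakk> \<Longrightarrow> m \<in> T"
    and new_old: "\<And>x y l l'. \<lbrakk>(x, l) \<in> X; (x, l') \<in> X; l \<noteq> l'; (y, l) \<in> I2; (y, l') \<in> I2\<rbrakk> \<Longrightarrow> y \<in> Y"
    and new_new: "\<And>x x' l l'. \<lbrakk>(x, l) \<in> X; (x', l) \<in> X; (x, l') \<in> X; (x', l') \<in> X\<rbrakk> \<Longrightarrow> x = x' \<or> l = l'"
  shows "configuration (v1 + (v2 - card Y)) ((b1 - card T) + b2) r k
    (P1 <+> (P2 - Y)) ((L1 - T) <+> L2)
    ({(Inl x, Inl m) | x m. (x, m) \<in> I1 \<and> m \<notin> T} \<union> {(Inl x, Inr l) | x l. (x, l) \<in> X} \<union>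
     {(Inr y, Inr l) | y l. (y, l) \<in> I2 \<and> y \<notin> Y})"
    (is "configuration _ _ _ _ ?P ?L ?I")
proof -
  note C1 = c1[unfolded configuration_iff] and C2 = c2[unfolded configuration_iff]
  have fin: "finite P1" "finite L1" "finite P2" "finite L2" "finite T" "finite Y" "finite X"
    using C1 C2 T Y X by (auto intro: finite_subset)
  have finrow: "finite {m. (x, m) \<in> I1}" for x
    by (rule finite_subset[OF _ fin(2)]) (use C1 in auto)
  have fincol: "finite {y. (y, l) \<in> I2}" for l
    by (rule finite_subset[OF _ fin(3)]) (use C2 in auto)
  have finX: "finite {l. (x, l) \<in> X}" "finite {x. (x, l) \<in> X}" for x l
    by (rule finite_subset[OF _ fin(4)], use X in auto)
       (rule finite_subset[OF _ fin(1)], use X in auto)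
  have mem [simp]:
    "(Inl x, Inl m) \<in> ?I \<longleftrightarrow> (x, m) \<in> I1 \<and> m \<notin> T"
    "(Inl x, Inr l) \<in> ?I \<longleftrightarrow> (x, l) \<in> X"
    "(Inr y, Inl m) \<notin> ?I"
    "(Inr y, Inr l) \<in> ?I \<longleftrightarrow> (y, l) \<in> I2 \<and> y \<notin> Y" for x y l m
    by auto
  have deg_old_point: "card {z. (Inl x, z) \<in> ?I} = r" if "x \<in> P1" for x
  proof -
    have "{z. (Inl x, z) \<in> ?I} = ({m. (x, m) \<in> I1} - {m \<in> T. (x, m) \<in> I1}) <+> {l. (x, l) \<in> X}"
      by auto
    moreover have "card {m. (x, m) \<in> I1} = r"
      using C1 that by simp
    moreover have "card {m \<in> T. (x, m) \<in> I1} \<le> card {m. (x, m) \<in> I1}"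
      by (rule card_mono) (use finrow in auto)
    ultimately show ?thesis
      using row[OF that] finrow finX fin
      by (simp add: card_Plus card_Diff_subset Collect_mono del: mem)
  qed
  have deg_new_point: "card {z. (Inr y, z) \<in> ?I} = r" if "y \<in> P2 - Y" for y
  proof -
    have "{z. (Inr y, z) \<in> ?I} = Inr ` {l. (y, l) \<in> I2}"
      using that by auto
    then show ?thesis
      using C2 that by (simp add: card_image del: mem)
  qed
  have deg_old_line: "card {z. (z, Inl m) \<in> ?I} = k" if "m \<in> L1 - T" for m
  proof -
    have "{z. (z, Inl m) \<in> ?I} = Inl ` {x. (x, m) \<in> I1}"
      using that by auto
    then show ?thesis
      using C1 that by (simp add: card_image del: mem)
  qed
  have deg_new_line: "card {z. (z, Inr l) \<in> ?I} = k" if "l \<in> L2" for l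
  proof -
    have "{z. (z, Inr l) \<in> ?I} = {x. (x, l) \<in> X} <+> ({y. (y, l) \<in> I2} - {y \<in> Y. (y, l) \<in> I2})"
      by auto
    moreover have "card {y. (y, l) \<in> I2} = k"
      using C2 that by simp
    moreover have "card {y \<in> Y. (y, l) \<in> I2} \<le> card {y. (y, l) \<in> I2}"
      by (rule card_mono) (use fincol in auto)
    ultimately show ?thesis
      using col[OF that] fincol finX fin
      by (simp add: card_Plus card_Diff_subset Collect_mono del: mem)
  qed
  have lin1: "x = x' \<or> m = m'"
    if "(x, m) \<in> I1" "(x', m) \<in> I1" "(x, m') \<in> I1" "(x', m') \<in> I1" for x x' m m'
    using C1 that by blast
  have lin2: "x = x' \<or> m = m'"
    if "(x, m) \<in> I2" "(x', m) \<in> I2" "(x, m') \<in> I2" "(x', m') \<in> I2" for x x' m m'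
    using C2 that by blast
  have lin: "u = w \<or> z = z'"
    if "(u, z) \<in> ?I" "(w, z) \<in> ?I" "(u, z') \<in> ?I" "(w, z') \<in> ?I" for u w z z'
    using that
    by (cases u; cases w; cases z; cases z'; simp only: mem sum.inject simp_thms)
       (use lin1 lin2 old_new new_old new_new in blast)+
  show ?thesis
    unfolding configuration_iff
  proof (intro conjI ballI allI impI)
    show "?I \<subseteq> ?P \<times> ?L"
      using C1 C2 X by auto
    show "card ?P = v1 + (v2 - card Y)" "card ?L = (b1 - card T) + b2"
      using C1 C2 T Y fin by (simp_all add: card_Plus card_Diff_subset)
    show "card {l. (p, l) \<in> ?I} = r" if "p \<in> ?P" for p
      using that deg_old_point deg_new_point by (elim PlusE) (simp_all del: mem)
    show "card {p. (p, l) \<in> ?I} = k" if "l \<in> ?L" for l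
      using that deg_old_line deg_new_line by (elim PlusE) (simp_all del: mem)
    show "u = w \<or> z = z'"
      if "(u, z) \<in> ?I" "(w, z) \<in> ?I" "(u, z') \<in> ?I" "(w, z') \<in> ?I" for u w z z'
      using lin[OF that] .
  qed (use C1 C2 fin in auto)
qed

section \<open>Restoring the lost incidences\<close>

text \<open>Distinct lines through \<open>p\<close> have no other point in common, so the sets of their points other than
  \<open>p\<close> are disjoint.\<close>

lemma pencil:
  assumes c: "configuration v b r k P L I"
    and T: "T \<subseteq> {m. (p, m) \<in> I}"
  defines "D \<equiv> {x. x \<noteq> p \<and> (\<exists>m\<in>T. (x, m) \<in> I)}"
  shows "finite D" "card D = card T * (k - 1)"
    and "\<And>x. x \<in> D \<Longrightarrow> card {m \<in> T. (x, m) \<in> I} = 1"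
    and "\<And>x. x \<noteq> p \<Longrightarrow> x \<notin> D \<Longrightarrow> {m \<in> T. (x, m) \<in> I} = {}"
proof -
  note C = c[unfolded configuration_iff]
  have lin: "x = x' \<or> m = m'"
    if "(x, m) \<in> I" "(x', m) \<in> I" "(x, m') \<in> I" "(x', m') \<in> I" for x x' m m'
    using C that by blast
  have fT: "finite T"
    by (rule finite_subset[of _ L]) (use C T in auto)
  have fcol: "finite {x. (x, m) \<in> I}" for m
    by (rule finite_subset[of _ P]) (use C in auto)
  have D: "D = (\<Union>m\<in>T. {x. (x, m) \<in> I} - {p})"
    unfolding D_def by auto
  show "finite D"
    unfolding D using fT fcol by simp
  have "card D = (\<Sum>m\<in>T. card ({x. (x, m) \<in> I} - {p}))"
    unfolding D
  proof (rule card_UN_disjoint)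
    show "\<forall>m\<in>T. \<forall>m'\<in>T. m \<noteq> m' \<longrightarrow> ({x. (x, m) \<in> I} - {p}) \<inter> ({x. (x, m') \<in> I} - {p}) = {}"
      using lin[of _ _ p] T by blast
  qed (use fT fcol in auto)
  also have "\<dots> = (\<Sum>m\<in>T. k - 1)"
  proof (rule sum.cong)
    fix m assume "m \<in> T"
    then have "(p, m) \<in> I" "m \<in> L"
      using T C by auto
    then show "card ({x. (x, m) \<in> I} - {p}) = k - 1"
      using C by simp
  qed simp
  finally show "card D = card T * (k - 1)"
    by simp
  show "card {m \<in> T. (x, m) \<in> I} = 1" if x: "x \<in> D" for x
  proof -
    from x obtain m where m: "m \<in> T" "(x, m) \<in> I" "x \<noteq> p"
      unfolding D_def by auto
    then have "{m \<in> T. (x, m) \<in> I} = {m}"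
      using lin[of x _ p] T by blast
    then show ?thesis
      by simp
  qed
  show "{m \<in> T. (x, m) \<in> I} = {}" if "x \<noteq> p" "x \<notin> D" for x
    using that unfolding D_def by auto
qed

text \<open>
  The hypothesis \<open>b * k = a * r\<close> makes the points left over for the bijection as many as the lines:
  after placing \<open>p\<close> on \<open>l\<close>, \<open>a - 1\<close> points on \<open>l\<close> and \<open>p\<close> on \<open>b - 1\<close> lines, there remain
  \<open>b (k - 1) - (a - 1)\<close> points and \<open>a (r - 1) - (b - 1)\<close> lines.
\<close>

lemma merged_configuration_exists:
  fixes P1 :: "'a set" and L1 :: "'b set" and P2 :: "'c set" and L2 :: "'d set"
  assumes c1: "configuration v1 b1 r k P1 L1 I1"
    and c2: "configuration v2 b2 r k P2 L2 I2"
    and "v1 > 0" "b2 > 0"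
    and a: "1 \<le> a" "a \<le> k" and b: "1 \<le> b" "b \<le> r" and ab: "b * k = a * r"
  shows "\<exists>(P :: ('a + 'c) set) (L :: ('b + 'd) set) I.
    configuration (v1 + (v2 - a)) ((b1 - b) + b2) r k P L I"
proof -
  note C1 = c1[unfolded configuration_iff] and C2 = c2[unfolded configuration_iff]
  have lin1: "x = x' \<or> m = m'"
    if "(x, m) \<in> I1" "(x', m) \<in> I1" "(x, m') \<in> I1" "(x', m') \<in> I1" for x x' m m'
    using C1 that by blast
  have lin2: "x = x' \<or> m = m'"
    if "(x, m) \<in> I2" "(x', m) \<in> I2" "(x, m') \<in> I2" "(x', m') \<in> I2" for x x' m m'
    using C2 that by blast
  obtain p where p: "p \<in> P1"
    using C1 \<open>v1 > 0\<close> by fastforce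
  obtain l where l: "l \<in> L2"
    using C2 \<open>b2 > 0\<close> by fastforce
  have "b \<le> card {m. (p, m) \<in> I1}"
    using C1 p b by simp
  then obtain T where T: "T \<subseteq> {m. (p, m) \<in> I1}" "card T = b" "finite T"
    by (rule obtain_subset_with_card_n)
  have "a \<le> card {y. (y, l) \<in> I2}"
    using C2 l a by simp
  then obtain Y where Y: "Y \<subseteq> {y. (y, l) \<in> I2}" "card Y = a" "finite Y"
    by (rule obtain_subset_with_card_n)
  obtain m where m: "m \<in> T"
    using T b by fastforce
  obtain y where y: "y \<in> Y"
    using Y a by fastforce
  define D where "D = {x. x \<noteq> p \<and> (\<exists>m\<in>T. (x, m) \<in> I1)}"
  define E where "E = {h. h \<noteq> l \<and> (\<exists>y\<in>Y. (y, h) \<in> I2)}"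
  have D: "finite D" "card D = b * (k - 1)"
    "\<And>x. x \<in> D \<Longrightarrow> card {m \<in> T. (x, m) \<in> I1} = 1"
    "\<And>x. x \<noteq> p \<Longrightarrow> x \<notin> D \<Longrightarrow> {m \<in> T. (x, m) \<in> I1} = {}"
    using pencil[OF c1 T(1)] T(2) unfolding D_def by auto
  have "Y \<subseteq> {y. (l, y) \<in> I2\<inverse>}"
    using Y by auto
  from pencil[OF configuration_dual[OF c2] this] Y(2)
  have E: "finite E" "card E = a * (r - 1)"
    "\<And>h. h \<in> E \<Longrightarrow> card {y \<in> Y. (y, h) \<in> I2} = 1"
    "\<And>h. h \<noteq> l \<Longrightarrow> h \<notin> E \<Longrightarrow> {y \<in> Y. (y, h) \<in> I2} = {}"
    unfolding E_def by auto
  have pm: "(p, m) \<in> I1" "m \<in> L1" and yl: "(y, l) \<in> I2" "y \<in> P2"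
    using T m Y y C1 C2 by auto
  have "a - 1 \<le> card ({x. (x, m) \<in> I1} - {p})"
    using C1 pm a by simp
  then obtain D0 where D0: "D0 \<subseteq> {x. (x, m) \<in> I1} - {p}" "card D0 = a - 1" "finite D0"
    by (rule obtain_subset_with_card_n)
  have "b - 1 \<le> card ({h. (y, h) \<in> I2} - {l})"
    using C2 yl b by simp
  then obtain E0 where E0: "E0 \<subseteq> {h. (y, h) \<in> I2} - {l}" "card E0 = b - 1" "finite E0"
    by (rule obtain_subset_with_card_n)
  have sub: "D0 \<subseteq> D" "E0 \<subseteq> E"
    using D0 E0 m y unfolding D_def E_def by auto
  have "b * (k - 1) - (a - 1) = a * (r - 1) - (b - 1)"
    using ab a b C1 by (simp add: diff_mult_distrib2)
  then have "card (D - D0) = card (E - E0)"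
    using D E D0 E0 sub by (simp add: card_Diff_subset)
  then obtain f where f: "bij_betw f (D - D0) (E - E0)"
    using finite_same_card_bij[of "D - D0" "E - E0"] D(1) E(1) by auto
  have pl: "p \<notin> D" "l \<notin> E"
    unfolding D_def E_def by auto
  define X where "X = insert p D0 \<times> {l} \<union> {p} \<times> E0 \<union> {(x, f x) | x. x \<in> D - D0}"
  have fE: "f x \<in> E" "f x \<notin> E0" "f x \<noteq> l" if "x \<in> D" "x \<notin> D0" for x
    using f that pl unfolding bij_betw_def by auto
  have finj: "x = x'" if "f x = f x'" "x \<in> D - D0" "x' \<in> D - D0" for x x'
    using f that unfolding bij_betw_def inj_on_def by blast
  have row_p: "{h. (p, h) \<in> X} = insert l E0"
    using pl sub unfolding X_def by auto
  have row_1: "\<exists>h. {h. (x, h) \<in> X} = {h}" if "x \<in> D" for x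
  proof (cases "x \<in> D0")
    case True
    then have "{h. (x, h) \<in> X} = {l}"
      using that pl unfolding X_def by auto
    then show ?thesis by blast
  next
    case False
    then have "{h. (x, h) \<in> X} = {f x}"
      using that pl unfolding X_def by auto
    then show ?thesis by blast
  qed
  have row_0: "{h. (x, h) \<in> X} = {}" if "x \<noteq> p" "x \<notin> D" for x
    using that sub unfolding X_def by auto
  have col_l: "{x. (x, l) \<in> X} = insert p D0"
    using pl sub fE unfolding X_def by auto
  have col_1: "\<exists>x. {x. (x, h) \<in> X} = {x}" if "h \<in> E" for h
  proof (cases "h \<in> E0")
    case True
    then have "{x. (x, h) \<in> X} = {p}"
      using that pl fE unfolding X_def by auto
    then show ?thesis by blast
  next
    case False
    then have "h \<in> f ` (D - D0)"
      using f that by (simp add: bij_betw_imp_surj_on)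
    then obtain x where x: "x \<in> D - D0" "h = f x"
      by blast
    then have "{x. (x, h) \<in> X} = {x}"
      using that False pl finj unfolding X_def by auto
    then show ?thesis by blast
  qed
  have col_0: "{x. (x, h) \<in> X} = {}" if "h \<noteq> l" "h \<notin> E" for h
    using that sub fE unfolding X_def by auto
  \<comment> \<open>Points of the first configuration placed on a common line were joined by the deleted line \<open>m\<close>, so by
    linearity no surviving line joins them; lines receiving a common point met in the deleted point
    \<open>y\<close>, so they meet in no surviving point.\<close>
  have common_line: "h = l \<and> (x, m) \<in> I1 \<and> (x', m) \<in> I1"
    if "(x, h) \<in> X" "(x', h) \<in> X" "x \<noteq> x'" for x x' h
  proof -
    have "{z. (z, h) \<in> X} \<noteq> {}" "{z. (z, h) \<in> X} \<noteq> {z}" for z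
      using that by (metis mem_Collect_eq empty_iff singletonD)+
    then have "h = l"
      using col_1[of h] col_0[of h] by blast
    moreover from this have "x \<in> {z. (z, l) \<in> X}" "x' \<in> {z. (z, l) \<in> X}"
      using that by simp_all
    ultimately show ?thesis
      unfolding col_l using D0(1) pm(1) by auto
  qed
  have common_point: "(y, h) \<in> I2 \<and> (y, h') \<in> I2"
    if "(x, h) \<in> X" "(x, h') \<in> X" "h \<noteq> h'" for x h h'
  proof -
    have "{z. (x, z) \<in> X} \<noteq> {}" "{z. (x, z) \<in> X} \<noteq> {z}" for z
      using that by (metis mem_Collect_eq empty_iff singletonD)+
    then have "x = p"
      using row_1[of x] row_0[of x] by blast
    then have "h \<in> {z. (p, z) \<in> X}" "h' \<in> {z. (p, z) \<in> X}"
      using that by simp_all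
    then show ?thesis
      unfolding row_p using E0(1) yl(1) by auto
  qed
  have "D \<subseteq> P1" "E \<subseteq> L2"
    using C1 C2 unfolding D_def E_def by auto
  have "configuration (v1 + (v2 - card Y)) ((b1 - card T) + b2) r k
    (P1 <+> (P2 - Y)) ((L1 - T) <+> L2)
    ({(Inl x, Inl m) | x m. (x, m) \<in> I1 \<and> m \<notin> T} \<union> {(Inl x, Inr l) | x l. (x, l) \<in> X} \<union>
     {(Inr y, Inr l) | y l. (y, l) \<in> I2 \<and> y \<notin> Y})"
  proof (rule configuration_glue[OF c1 c2])
    show "T \<subseteq> L1" "Y \<subseteq> P2"
      using T Y C1 C2 by auto
    show "X \<subseteq> P1 \<times> L2"
      using \<open>D \<subseteq> P1\<close> \<open>E \<subseteq> L2\<close> p l sub fE unfolding X_def by auto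
    show "card {h. (x, h) \<in> X} = card {m \<in> T. (x, m) \<in> I1}" for x
    proof -
      consider "x = p" | "x \<in> D" | "x \<noteq> p" "x \<notin> D"
        by blast
      then show ?thesis
      proof cases
        case 1
        have "{m \<in> T. (p, m) \<in> I1} = T" "l \<notin> E0"
          using T E0 by auto
        then show ?thesis
          using 1 row_p T E0 b by simp
      next
        case 2
        then obtain h where "{h. (x, h) \<in> X} = {h}"
          using row_1 by blast
        then show ?thesis
          unfolding D(3)[OF 2] by simp
      next
        case 3
        then show ?thesis
          unfolding row_0[OF 3] D(4)[OF 3] by simp
      qed
    qed
    show "card {x. (x, h) \<in> X} = card {y \<in> Y. (y, h) \<in> I2}" for h
    proof -
      consider "h = l" | "h \<in> E" | "h \<noteq> l" "h \<notin> E"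
        by blast
      then show ?thesis
      proof cases
        case 1
        have "{y \<in> Y. (y, l) \<in> I2} = Y" "p \<notin> D0"
          using Y D0 by auto
        then show ?thesis
          using 1 col_l Y D0 a by simp
      next
        case 2
        then obtain x where "{x. (x, h) \<in> X} = {x}"
          using col_1 by blast
        then show ?thesis
          unfolding E(3)[OF 2] by simp
      next
        case 3
        then show ?thesis
          unfolding col_0[OF 3] E(4)[OF 3] by simp
      qed
    qed
    show "m' \<in> T"
      if "(x, h) \<in> X" "(x', h) \<in> X" "x \<noteq> x'" "(x, m') \<in> I1" "(x', m') \<in> I1" for x x' h m'
      using common_line[OF that(1-3)] lin1[of x m' x' m] that m by blast
    show "y' \<in> Y"
      if "(x, h) \<in> X" "(x, h') \<in> X" "h \<noteq> h'" "(y', h) \<in> I2" "(y', h') \<in> I2" for x y' h h'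
      using common_point[OF that(1-3)] lin2[of y h y' h'] that y by blast
    show "x = x' \<or> h = h'"
      if "(x, h) \<in> X" "(x', h) \<in> X" "(x, h') \<in> X" "(x', h') \<in> X" for x x' h h'
      using common_line that by blast
  qed
  then show ?thesis
    unfolding T(2) Y(2) by blast
qed

section \<open>The pattern\<close>

text \<open>A configuration has at least the \<open>k\<close> points of one of its lines. This keeps \<open>d + e - n\<close> positive.\<close>

lemma config_semigroup_ge_gcd:
  assumes "d \<in> config_semigroup r k" "d > 0" "r \<ge> 2" "k \<ge> 2"
  shows "gcd r k \<le> d"
proof -
  let ?g = "gcd r k"
  obtain P L :: "nat set" and I where
    c: "configuration (d * (k div ?g)) (d * (r div ?g)) r k P L I"
    using assms unfolding config_semigroup_def by auto
  have pos: "k div ?g > 0" "r div ?g > 0"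
    using assms by (simp_all add: div_greater_zero_iff gcd_le1_nat gcd_le2_nat)
  then have "card L > 0"
    using c \<open>d > 0\<close> unfolding configuration_def by simp
  then obtain l where "l \<in> L"
    by fastforce
  then have "k = card {p \<in> P. (p, l) \<in> I}"
    using c unfolding configuration_def by simp
  also have "\<dots> \<le> card P"
    using c unfolding configuration_def by (intro card_mono) auto
  also have "\<dots> = d * (k div ?g)"
    using c unfolding configuration_def by simp
  finally have "?g * (k div ?g) \<le> d * (k div ?g)"
    by simp
  then show ?thesis
    using pos(1) mult_le_cancel2 by blast
qed

lemma config_semigroup_merge:
  assumes d: "d \<in> config_semigroup r k" "d > 0" and e: "e \<in> config_semigroup r k" "e > 0"
    and rk: "r \<ge> 2" "k \<ge> 2" and n: "1 \<le> n" "n \<le> gcd r k"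
  shows "d + e - n \<in> config_semigroup r k"
proof -
  define g where "g = gcd r k"
  define k' where "k' = k div g"
  define r' where "r' = r div g"
  obtain P1 L1 :: "nat set" and I1 where c1: "configuration (d * k') (d * r') r k P1 L1 I1"
    using d unfolding config_semigroup_def g_def k'_def r'_def by auto
  obtain P2 L2 :: "nat set" and I2 where c2: "configuration (e * k') (e * r') r k P2 L2 I2"
    using e unfolding config_semigroup_def g_def k'_def r'_def by auto
  have r: "r = g * r'" and k: "k = g * k'"
    unfolding g_def k'_def r'_def by simp_all
  have pos: "r' > 0" "k' > 0"
    using rk r k by (auto intro: gr0I)
  have le: "n \<le> g" "n \<le> d" "n \<le> e"
    using n config_semigroup_ge_gcd[OF d rk] config_semigroup_ge_gcd[OF e rk]
    unfolding g_def by auto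
  have "\<exists>(P :: (nat + nat) set) (L :: (nat + nat) set) I.
    configuration (d * k' + (e * k' - n * k')) ((d * r' - n * r') + e * r') r k P L I"
  proof (rule merged_configuration_exists[OF c1 c2])
    show "n * k' \<le> k" "n * r' \<le> r"
      using le unfolding r k by simp_all
    show "n * r' * k = n * k' * r"
      unfolding r k by simp
  qed (use d e n pos in auto)
  moreover have "d * k' + (e * k' - n * k') = (d + e - n) * k'"
    "(d * r' - n * r') + e * r' = (d + e - n) * r'"
    using le by (simp_all add: algebra_simps diff_mult_distrib)
  ultimately obtain P L :: "(nat + nat) set" and I where
    "configuration ((d + e - n) * k') ((d + e - n) * r') r k P L I"
    by auto
  from configuration_image[OF this inj_sum_encode inj_sum_encode]
  have "\<exists>(P :: nat set) (L :: nat set) I.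
    configuration ((d + e - n) * k') ((d + e - n) * r') r k P L I"
    by blast
  moreover have "d + e - n > 0"
    using d le by simp
  ultimately show ?thesis
    unfolding config_semigroup_def g_def k'_def r'_def by blast
qed

theorem theorem9:
  fixes r k n :: nat
  assumes "r \<ge> 2" and "k \<ge> 2" and "n \<in> {1..gcd r k}"
  shows "admits_pattern_on (config_semigroup r k - {0}) (config_semigroup r k) 2
           (mp_var 1 + mp_var 2 - of_nat n)"
proof -
  have n: "n > 0" "1 \<le> n" "n \<le> gcd r k"
    using assms(3) by auto
  have "int d + int e - int n \<in> int ` config_semigroup r k"
    if "d \<in> config_semigroup r k - {0}" "e \<in> config_semigroup r k - {0}" for d e
  proof -
    have "n \<le> d"
      using config_semigroup_ge_gcd[of d r k] that assms by auto
    then have "int d + int e - int n = int (d + e - n)"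
      by simp
    moreover have "d + e - n \<in> config_semigroup r k"
      using config_semigroup_merge[of d r k e n] that assms n by auto
    ultimately show ?thesis
      by (metis imageI)
  qed
  then show ?thesis
    unfolding admits_pattern_on_def mp_sum_minus_const[OF n(1)] by auto
qed

end
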